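(* For every integer $k \geq 1$, \[ \frac{2k+3}{4k^2+9k+5} < \left| \ln(2) - AHS_k \right| < \frac{1}{2k+1}. \]
   Context: For an integer $k \geq 1$, $AHS_k$ denotes the $k$th partial sum of the alternating harmonic series, $AHS_k := \sum_{i=1}^{k} (-1)^{i+1} \frac{1}{i}$. *)

theory Defs
  imports Complex_Main
begin

definition AHS :: "nat \<Rightarrow> real" where
  "AHS k = (\<Sum>i=1..k. (-1) ^ (i + 1) * (1 / real i))"

end

theory Submission
  imports Defs "HOL-Analysis.Harmonic_Numbers" "HOL-Real_Asymp.Real_Asymp"
begin

text \<open>The signed error \<open>e k = (-1)^k * (ln 2 - AHS k)\<close> satisfies
  \<open>e k - e (k + 2) = 1/(k+1) - 1/(k+2)\<close> and tends to \<open>0\<close>. The upper bound telescopes in steps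
  of two by strictly more than this and the lower bound by strictly less, and both tend to \<open>0\<close>.\<close>

text \<open>Along each parity class \<open>d\<close> decreases to its limit \<open>0\<close>, so no
  term is negative. Starting the subsequence at \<open>k + 2\<close> leaves one strict step, from
  \<open>d (k + 2)\<close> to \<open>d k\<close>, which excludes equality.\<close>

lemma pos_of_step_two_decreasing_tendsto_0:
  fixes d :: "nat \<Rightarrow> real"
  assumes lim: "d \<longlonglongrightarrow> 0" and dec: "\<And>k. d (k + 2) < d k"
  shows "0 < d k"
proof -
  have "decseq (\<lambda>n. d (k + 2 + 2 * n))"
    using dec by (intro decseq_SucI) (metis add.assoc less_eq_real_def mult_Suc_right add.commute)
  moreover have "(\<lambda>n. d (k + 2 + 2 * n)) \<longlonglongrightarrow> 0"
    using LIMSEQ_subseq_LIMSEQ[OF lim, of "\<lambda>n. k + 2 + 2 * n"]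
    by (simp add: strict_mono_def o_def)
  ultimately have "0 \<le> d (k + 2 + 2 * 0)"
    by (rule decseq_ge)
  with dec[of k] show ?thesis
    by simp
qed

lemma AHS_LIMSEQ: "AHS \<longlonglongrightarrow> ln 2"
proof -
  have "(\<lambda>k. (-1) ^ k / real (Suc k)) sums ln 2"
    using alternating_harmonic_series_sums by simp
  then have "(\<lambda>n. \<Sum>k<n. (-1) ^ k / real (Suc k)) \<longlonglongrightarrow> ln 2"
    by (simp add: sums_def)
  moreover have "(\<Sum>k<n. (-1) ^ k / real (Suc k)) = AHS n" for n
    unfolding AHS_def by (induction n) auto
  ultimately show ?thesis
    by simp
qed

text \<open>\<open>(-1) ^ k\<close> is the sign of the first omitted term, so this turns out to be
  the absolute error, in a form free of absolute values.\<close>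

definition signed_error :: "nat \<Rightarrow> real" where
  "signed_error k = (-1) ^ k * (ln 2 - AHS k)"

lemma signed_error_LIMSEQ: "signed_error \<longlonglongrightarrow> 0"
proof -
  have "(\<lambda>k. ln 2 - AHS k) \<longlonglongrightarrow> 0"
    using tendsto_diff[OF tendsto_const AHS_LIMSEQ, of "ln 2"] by simp
  then have "(\<lambda>k. \<bar>signed_error k\<bar>) \<longlonglongrightarrow> 0"
    by (simp add: signed_error_def abs_mult tendsto_rabs_zero)
  then show ?thesis
    by (rule tendsto_rabs_zero_cancel)
qed

text \<open>The sign factor is the same at \<open>k\<close> and \<open>k + 2\<close>, so only the
  two terms of the series between them survive.\<close>

lemma signed_error_step:
  "signed_error k - signed_error (k + 2) = 1 / ((real k + 1) * (real k + 2))"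
proof -
  have "signed_error k - signed_error (k + 2)
      = ((-1) ^ k * (-1) ^ k) * (1 / (real k + 1) - 1 / (real k + 2))"
    by (simp add: signed_error_def AHS_def algebra_simps)
  also have "(-1) ^ k * (-1) ^ k = (1 :: real)"
    by (simp flip: power_add)
  finally show ?thesis
    by (simp add: field_simps)
qed

lemma signed_error_less: "signed_error k < 1 / (2 * real k + 1)"
proof -
  have "0 < 1 / (2 * real k + 1) - signed_error k"
  proof (rule pos_of_step_two_decreasing_tendsto_0[where d = "\<lambda>k. 1 / (2 * real k + 1) - signed_error k"])
    have "(\<lambda>k. 1 / (2 * real k + 1)) \<longlonglongrightarrow> 0"
      by real_asymp
    from tendsto_diff[OF this signed_error_LIMSEQ]
    show "(\<lambda>k. 1 / (2 * real k + 1) - signed_error k) \<longlonglongrightarrow> 0"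
      by simp
  next
    fix k
    \<comment> \<open>With numerator 4 on both sides, the denominators are
      \<open>4*k^2 + 12*k + 8\<close> on the left and \<open>4*k^2 + 12*k + 5\<close> on the
      right.\<close>
    have "1 / ((real k + 1) * (real k + 2)) < 1 / (2 * real k + 1) - 1 / (2 * real (k + 2) + 1)"
      by (simp add: divide_simps) (simp add: algebra_simps)
    then show "1 / (2 * real (k + 2) + 1) - signed_error (k + 2) < 1 / (2 * real k + 1) - signed_error k"
      using signed_error_step[of k] by linarith
  qed
  then show ?thesis
    by simp
qed

lemma less_signed_error:
  "(2 * real k + 3) / (4 * (real k)^2 + 9 * real k + 5) < signed_error k"
proof -
  \<comment> \<open>Partial fractions of the claimed bound, whose denominator factors as
    \<open>(x + 1) * (4 * x + 5)\<close>.\<close>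
  define L where "L x = 1 / (x + 1) - 2 / (4 * x + 5)" for x :: real
  have "0 < signed_error k - L (real k)"
  proof (rule pos_of_step_two_decreasing_tendsto_0[where d = "\<lambda>k. signed_error k - L (real k)"])
    have "(\<lambda>k. L (real k)) \<longlonglongrightarrow> 0"
      unfolding L_def by real_asymp
    from tendsto_diff[OF signed_error_LIMSEQ this]
    show "(\<lambda>k. signed_error k - L (real k)) \<longlonglongrightarrow> 0"
      by simp
  next
    fix k
    have "L x - L (x + 2) < 1 / ((x + 1) * (x + 2))" if "x \<ge> 0" for x
    proof -
      \<comment> \<open>Over a common denominator the gap has only positive coefficients, hence is
        positive for \<open>x \<ge> 0\<close>.\<close>
      have "1 / ((x + 1) * (x + 2)) - (L x - L (x + 2))
          = (8 * x^2 + 39 * x + 31) / ((x + 1) * (x + 2) * (x + 3) * (4 * x + 5) * (4 * x + 13))"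
        using that unfolding L_def by (simp add: divide_simps) (simp add: algebra_simps power2_eq_square)
      moreover have "0 < \<dots>"
        using that by (intro divide_pos_pos mult_pos_pos add_nonneg_pos) auto
      ultimately show ?thesis
        by simp
    qed
    from this[of "real k"]
    show "signed_error (k + 2) - L (real (k + 2)) < signed_error k - L (real k)"
      using signed_error_step[of k] by (simp add: add.commute)
  qed
  moreover have "L (real k) = (2 * real k + 3) / (4 * (real k)^2 + 9 * real k + 5)"
  proof -
    have "4 * (real k)^2 + 9 * real k + 5 = (real k + 1) * (4 * real k + 5)"
      by (simp add: algebra_simps power2_eq_square)
    then show ?thesis
      by (simp add: L_def divide_simps)
  qed
  ultimately show ?thesis
    by simp
qed

theorem proposition5:
  fixes k :: nat
  assumes "k \<ge> 1"
  shows "(2 * real k + 3) / (4 * (real k)^2 + 9 * real k + 5) < \<bar>ln 2 - AHS k\<bar> \<and>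
         \<bar>ln 2 - AHS k\<bar> < 1 / (2 * real k + 1)"
proof -
  \<comment> \<open>The lower bound is nonnegative, so it also settles the sign and identifies
    \<open>signed_error k\<close> with the absolute error.\<close>
  have "0 < signed_error k"
    by (rule le_less_trans[OF _ less_signed_error]) simp
  moreover have "\<bar>signed_error k\<bar> = \<bar>ln 2 - AHS k\<bar>"
    by (simp add: signed_error_def abs_mult)
  ultimately show ?thesis
    using less_signed_error[of k] signed_error_less[of k] by simp
qed

end
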